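(* Let $M$ be such that $K=\log_2 M$ is a positive integer, let $E_b$ be the bit energy, $N_0/2$ the two-sided noise power spectral density, and $d=\sqrt{\frac{3\log_2(M)E_b}{M^2-1}}$. Consider $M$-ary PAM over the AWGN channel with amplitudes $\pm d,\pm3d,\dots,\pm(M-1)d$ labeled by the standard $K$-bit binary reflected Gray code sequence, as described in the context. For $1\le k\le K$, let $b_{K,k}$ be the $k$-th bit (from the left) of a symbol. With the sets $\mathcal{R}^{(1)}_{K,k},\mathcal{R}^{(0)}_{K,k},\mathcal{A}^{(1)}_{K,k},\mathcal{A}^{(0)}_{K,k}$, the index sets $\mathbf{p}^{(1)}_k,\mathbf{p}^{(0)}_k,\overline{\mathbf{p}}^{(1)}_k,\overline{\mathbf{p}}^{(0)}_k,\mathbf{j}^{\overline p^{(1)}}_{K,k},\mathbf{j}^{\overline p^{(0)}}_{K,k}$ and the numbers $\delta^{p,l}_{K,k},\delta^{p,u}_{K,k},A^{\overline p,j}_{K,k}$ defined in the context, the error probability $P_{\mathrm{PAM}}(b_{K,k})$ of $b_{K,k}$ is $$\begin{aligned} P_{\mathrm{PAM}}(b_{K,k})&=\Pr\big(r\odot\mathcal{R}^{(1)}_{K,k}\,\big|\,s\in\mathcal{A}^{(0)}_{K,k}\big)+\Pr\big(r\odot\mathcal{R}^{(0)}_{K,k}\,\big|\,s\in\mathcal{A}^{(1)}_{K,k}\big)\\ &=\frac{1}{MK}\Bigg(\sum_{s\in\mathcal{A}^{(0)}_{K,k}}\Pr\big(r\odot\mathcal{R}^{(1)}_{K,k}\big)+\sum_{s\in\mathcal{A}^{(1)}_{K,k}}\Pr\big(r\odot\mathcal{R}^{(0)}_{K,k}\big)\Bigg)\\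 &=\frac{1}{MK}\Bigg(\sum_{\overline p^{(0)}\in\overline{\mathbf{p}}^{(0)}_k}\ \sum_{j^{(0)}\in\mathbf{j}^{\overline p^{(0)}}_{K,k}}\ \sum_{p^{(1)}\in\mathbf{p}^{(1)}_k}\Pr\Big(\delta^{p^{(1)},l}_{K,k}d\le A^{\overline p^{(0)},j^{(0)}}_{K,k}d+n<\delta^{p^{(1)},u}_{K,k}d\Big)\\ &\qquad\quad+\sum_{\overline p^{(1)}\in\overline{\mathbf{p}}^{(1)}_k}\ \sum_{j^{(1)}\in\mathbf{j}^{\overline p^{(1)}}_{K,k}}\ \sum_{p^{(0)}\in\mathbf{p}^{(0)}_k}\Pr\Big(\delta^{p^{(0)},l}_{K,k}d\le A^{\overline p^{(1)},j^{(1)}}_{K,k}d+n<\delta^{p^{(0)},u}_{K,k}d\Big)\Bigg)\\ &=\frac{1}{2MK}\Bigg(\sum_{\overline p^{(0)}\in\overline{\mathbf{p}}^{(0)}_k}\ \sum_{j^{(0)}\in\mathbf{j}^{\overline p^{(0)}}_{K,k}}\ \sum_{p^{(1)}\in\mathbf{p}^{(1)}_k}\bigg[\operatorname{erfc}\Big(\tfrac{d}{\sqrt{N_0}}\big(\delta^{p^{(1)},l}_{K,k}-A^{\overline p^{(0)},j^{(0)}}_{K,k}\big)\Big)-\operatorname{erfc}\Big(\tfrac{d}{\sqrt{N_0}}\big(\delta^{p^{(1)},u}_{K,k}-A^{\overline p^{(0)},j^{(0)}}_{K,k}\big)\Big)\bigg]\\ &\qquad\quad+\sum_{\overline p^{(1)}\in\overline{\mathbf{p}}^{(1)}_k}\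 \sum_{j^{(1)}\in\mathbf{j}^{\overline p^{(1)}}_{K,k}}\ \sum_{p^{(0)}\in\mathbf{p}^{(0)}_k}\bigg[\operatorname{erfc}\Big(\tfrac{d}{\sqrt{N_0}}\big(\delta^{p^{(0)},l}_{K,k}-A^{\overline p^{(1)},j^{(1)}}_{K,k}\big)\Big)-\operatorname{erfc}\Big(\tfrac{d}{\sqrt{N_0}}\big(\delta^{p^{(0)},u}_{K,k}-A^{\overline p^{(1)},j^{(1)}}_{K,k}\big)\Big)\bigg]\Bigg). \end{aligned}$$
   Context: **Gray code.** $\mathcal{G}_1=(1,0)$; for $n\ge2$, $\mathcal{G}_n$ is the concatenation of the sequence obtained by prefixing (on the left) $1$ to each codeword of $\mathcal{G}_{n-1}$ and the sequence obtained by prefixing $0$ to each codeword of $\mathcal{G}_{n-1}$ listed in reverse order. This is the standard $n$-bit binary reflected Gray code sequence. **Signal model.** The signal waveform is $s(t)=A_M\cos 2\pi f_ct$, $0\le t<T$, with carrier frequency $f_c$, symbol duration $T$ and amplitude $A_M\in\{\pm d,\pm3d,\dots,\pm(M-1)d\}$; the received waveform is $r(t)=s(t)+n(t)$, where $n(t)$ is zero-mean additive white Gaussian noise with two-sided power spectral density $N_0/2$. The time index is omitted: $r=s+n$, where $s$ is the transmitted amplitude (the $M$ symbols being equiprobable) and $n$ is Gaussian with mean $0$ and variance $N_0/2$, independent of $s$. The $i$-th codeword of $\mathcal{G}_K$ ($1\le i\le M=2^K$) is assigned to the amplitude $(2i-1-M)d$. **The function $\Delta$.** $\Delta(-1,K,k)=-\infty$,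 $\Delta(2^{k-1},K,k)=+\infty$, and for $-1<x<2^{k-1}$, $$\Delta(x,K,k)=-2^K\Big(1-\frac1{2^{k-1}}\Big)+x\cdot2^{K-k+2}.$$ **Decision regions.** $\mathbf{p}^{(1)}_k=\{-1\}$ if $k=1$ and $\{-1,0,\dots,2^{k-2}-1\}$ if $k\ge2$; $\mathbf{p}^{(0)}_k=\{-1\}$ if $k=1$ and $\{-1,0,\dots,2^{k-2}-2\}$ if $k\ge2$ (for $k=2$ this is $\{-1\}$). For $p^{(1)}\in\mathbf{p}^{(1)}_k$: $\delta^{p^{(1)},l}_{K,k}=\Delta(2p^{(1)}+1,K,k)$ and $\delta^{p^{(1)},u}_{K,k}=\Delta(2p^{(1)}+2,K,k)$. For $p^{(0)}\in\mathbf{p}^{(0)}_k$: $\delta^{p^{(0)},l}_{K,k}=\Delta(2p^{(0)}+2,K,k)$ and $\delta^{p^{(0)},u}_{K,k}=\Delta(2p^{(0)}+3,K,k)$. For $b\in\{0,1\}$, $\mathcal{R}^{(b)}_{K,k}$ is the set of intervals $\big(\delta^{p,l}_{K,k}d,\ \delta^{p,u}_{K,k}d\big)$, $p\in\mathbf{p}^{(b)}_k$; these are the decision regions of bit value $b$. The notation $r\odot\mathcal{R}^{(b)}_{K,k}$ means that $\delta^{p,l}_{K,k}d\le r<\delta^{p,u}_{K,k}d$ for some $p\in\mathbf{p}^{(b)}_k$. The receiver decides $b_{K,k}=1$ if $r\odot\mathcal{R}^{(1)}_{K,k}$ and $b_{K,k}=0$ if $r\odot\mathcal{R}^{(0)}_{K,k}$.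 The bit is decoded wrongly when $r$ falls into the decision regions of `1' given that $s$ is at a position of a `0', or vice versa. **Bit positions.** $\mathcal{A}^{(1)}_{K,k}$ and $\mathcal{A}^{(0)}_{K,k}$ are the sets of amplitudes (positions) of the symbols whose $k$-th bit is $1$ and $0$, respectively. Let $\overline{\mathbf{p}}_k=\left(-\tfrac12,0,1,\dots,2^{k-1}-1,2^{k-1}-\tfrac12\right)$ (for $k=1$: $(-\tfrac12,0,\tfrac12)$). For an element $x$ of $\overline{\mathbf{p}}_k$ other than the last, with successor $x^+$ in $\overline{\mathbf{p}}_k$, put $l(x,K,k)=\Delta(x^+,K,k)-\Delta(x,K,k)=(x^+-x)\cdot2^{K-k+2}$, where the finite formula for $\Delta$ is used at every element of $\overline{\mathbf{p}}_k$. Further, $\overline{\mathbf{p}}^{(1)}_k=\{-\tfrac34\}$ if $k=1$ and $\{-\tfrac34,0,1,\dots,2^{k-2}-1\}$ if $k\ge2$; and $\overline{\mathbf{p}}^{(0)}_k=\mathbf{p}^{(0)}_k$. For $\overline p^{(1)}\in\overline{\mathbf{p}}^{(1)}_k$: $\mathbf{j}^{\overline p^{(1)}}_{K,k}=\{0,1,\dots,\tfrac12l(2\overline p^{(1)}+1,K,k)-1\}$ and, for $j$ in this set, $A^{\overline p^{(1)},j}_{K,k}=\Delta(2\overline p^{(1)}+1,K,k)+2j+1$. For $\overline p^{(0)}\in\overline{\mathbf{p}}^{(0)}_k$: $\mathbf{j}^{\overline p^{(0)}}_{K,k}=\{0,1,\dots,\tfrac12l(2\overline p^{(0)}+2,K,k)-1\}$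 and, for $j$ in this set, $A^{\overline p^{(0)},j}_{K,k}=\Delta(2\overline p^{(0)}+2,K,k)+2j+1$. The sets $\mathcal{A}^{(1)}_{K,k}$ and $\mathcal{A}^{(0)}_{K,k}$ consist of the values $A^{\overline p^{(1)},j}_{K,k}d$ and $A^{\overline p^{(0)},j}_{K,k}d$, respectively. **Conventions.** In the sums over $s\in\mathcal{A}^{(b)}_{K,k}$, the probabilities are over $n$ with $r=s+n$. $\operatorname{erfc}(x)=\frac{2}{\sqrt\pi}\int_x^\infty e^{-t^2}\,dt$, with $\operatorname{erfc}(-\infty)=2$ and $\operatorname{erfc}(+\infty)=0$.
   Formalization: The first two equalities conflict (K=1: 2q versus q). Here P_PAM(b_{K,k}) is the probability that a uniformly chosen one of the K bits is the k-th and is wrong, i.e. its error probability over K, and each conditional probability in line 1 is weighted by its prior, 1/(2K). *)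

theory Defs
  imports "HOL-Probability.Probability"
begin

text \<open>Bit values are booleans, with \<open>True\<close> for 1 and \<open>False\<close> for 0.\<close>

subsection \<open>Gray code and amplitudes\<close>

fun gray :: "nat \<Rightarrow> bool list list" where
  "gray 0 = [[]]"
| "gray (Suc n) = map (Cons True) (gray n) @ map (Cons False) (rev (gray n))"

text \<open>The recursion is anchored at 0 instead of 1; it yields the intended one-bit sequence.\<close>

lemma gray_1: "gray 1 = [[True], [False]]"
  by simp

text \<open>Amplitude carrying the \<open>i\<close>-th codeword, \<open>1 \<le> i \<le> M\<close>.\<close>

definition amplitude :: "nat \<Rightarrow> real \<Rightarrow> nat \<Rightarrow> real" where
  "amplitude M d i = (2 * real i - 1 - real M) * d"

text \<open>Amplitudes of the symbols whose \<open>k\<close>-th bit from the left (counted from 1) is \<open>b\<close>.\<close>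

definition bit_positions :: "bool \<Rightarrow> nat \<Rightarrow> nat \<Rightarrow> real \<Rightarrow> real set" where
  "bit_positions b K k d =
     {amplitude (2 ^ K) d i | i. i \<in> {1..2 ^ K} \<and> gray K ! (i - 1) ! (k - 1) = b}"

subsection \<open>Decision regions\<close>

definition Delta_fin :: "real \<Rightarrow> nat \<Rightarrow> nat \<Rightarrow> real" where
  "Delta_fin x K k = - (2 ^ K) * (1 - 1 / 2 ^ (k - 1)) + x * 2 ^ (K - k + 2)"

definition Delta :: "real \<Rightarrow> nat \<Rightarrow> nat \<Rightarrow> ereal" where
  "Delta x K k =
     (if x = -1 then -\<infinity> else if x = 2 ^ (k - 1) then \<infinity> else ereal (Delta_fin x K k))"

definition p_set :: "bool \<Rightarrow> nat \<Rightarrow> real set" where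
  "p_set b k =
     (if k = 1 then {-1}
      else if b then real_of_int ` {-1..2 ^ (k - 2) - 1}
      else real_of_int ` {-1..2 ^ (k - 2) - 2})"

definition delta_l :: "bool \<Rightarrow> real \<Rightarrow> nat \<Rightarrow> nat \<Rightarrow> ereal" where
  "delta_l b p K k = (if b then Delta (2 * p + 1) K k else Delta (2 * p + 2) K k)"

definition delta_u :: "bool \<Rightarrow> real \<Rightarrow> nat \<Rightarrow> nat \<Rightarrow> ereal" where
  "delta_u b p K k = (if b then Delta (2 * p + 2) K k else Delta (2 * p + 3) K k)"

text \<open>An interval is represented by the pair of its end points.\<close>

definition regions :: "bool \<Rightarrow> nat \<Rightarrow> nat \<Rightarrow> real \<Rightarrow> (ereal \<times> ereal) set" where
  "regions b K k d = (\<lambda>p. (delta_l b p K k * ereal d, delta_u b p K k * ereal d)) ` p_set b k"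

definition in_regions :: "real \<Rightarrow> (ereal \<times> ereal) set \<Rightarrow> bool" (infix \<open>\<odot>\<close> 50) where
  "r \<odot> R \<longleftrightarrow> (\<exists>(l, u) \<in> R. l \<le> ereal r \<and> ereal r < u)"

subsection \<open>Parametrisation of the bit positions\<close>

definition pbar :: "nat \<Rightarrow> real set" where
  "pbar k = {-1/2} \<union> real ` {0..<2 ^ (k - 1)} \<union> {2 ^ (k - 1) - 1/2}"

text \<open>Successor of \<open>x\<close> in the increasing sequence of the elements of \<open>pbar k\<close>.\<close>

definition pbar_succ :: "nat \<Rightarrow> real \<Rightarrow> real" where
  "pbar_succ k x = Min {y \<in> pbar k. x < y}"

definition run_length :: "real \<Rightarrow> nat \<Rightarrow> nat \<Rightarrow> real" where
  "run_length x K k = Delta_fin (pbar_succ k x) K k - Delta_fin x K k"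

definition pbar_set :: "bool \<Rightarrow> nat \<Rightarrow> real set" where
  "pbar_set b k =
     (if b then (if k = 1 then {-3/4} else insert (-3/4) (real_of_int ` {0..2 ^ (k - 2) - 1}))
      else p_set False k)"

definition j_set :: "bool \<Rightarrow> real \<Rightarrow> nat \<Rightarrow> nat \<Rightarrow> nat set" where
  "j_set b p K k =
     {j. real j \<le> run_length (if b then 2 * p + 1 else 2 * p + 2) K k / 2 - 1}"

definition A_val :: "bool \<Rightarrow> real \<Rightarrow> nat \<Rightarrow> nat \<Rightarrow> nat \<Rightarrow> real" where
  "A_val b p j K k = Delta_fin (if b then 2 * p + 1 else 2 * p + 2) K k + 2 * real j + 1"

subsection \<open>Bit error probability\<close>

text \<open>
  On a probability space \<open>\<Omega>\<close> carrying the transmitted amplitude \<open>s\<close> and the noise \<open>n\<close>, the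
  \<open>k\<close>-th bit is decoded wrongly if the received value lies in a decision region of the bit value
  that was not sent.
\<close>

definition wrong_bit ::
  "('w \<Rightarrow> real) \<Rightarrow> ('w \<Rightarrow> real) \<Rightarrow> nat \<Rightarrow> nat \<Rightarrow> real \<Rightarrow> 'w \<Rightarrow> bool" where
  "wrong_bit s n K k d \<omega> \<longleftrightarrow>
     (\<exists>b. s \<omega> \<in> bit_positions b K k d \<and> (s \<omega> + n \<omega>) \<odot> regions (\<not> b) K k d)"

text \<open>
  The normalisation \<open>1 / (M * K)\<close> of the error probability counts bits, not symbols: the
  \<open>M * K\<close> bits of the constellation are equiprobable, i.e. one of the \<open>K\<close> bits of the transmitted
  symbol is inspected, at a uniformly random place \<open>c\<close> independent of everything else. The error
  probability of the \<open>k\<close>-th bit is the probability that the inspected bit is the \<open>k\<close>-th one and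
  that it is wrong; summing it over \<open>k\<close> gives the average bit error probability.
\<close>

definition bit_experiment :: "nat \<Rightarrow> 'w measure \<Rightarrow> (nat \<times> 'w) measure" where
  "bit_experiment K \<Omega> = measure_pmf (pmf_of_set {1..K}) \<Otimes>\<^sub>M \<Omega>"

definition P_PAM ::
  "'w measure \<Rightarrow> ('w \<Rightarrow> real) \<Rightarrow> ('w \<Rightarrow> real) \<Rightarrow> nat \<Rightarrow> nat \<Rightarrow> real \<Rightarrow> real" where
  "P_PAM \<Omega> s n K k d =
     \<P>(x in bit_experiment K \<Omega>. fst x = k \<and> wrong_bit s n K k d (snd x))"

text \<open>Probability that the inspected bit is the \<open>k\<close>-th one and that its value is \<open>b\<close>.\<close>

definition bit_weight ::
  "'w measure \<Rightarrow> ('w \<Rightarrow> real) \<Rightarrow> bool \<Rightarrow> nat \<Rightarrow> nat \<Rightarrow> real \<Rightarrow> real" where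
  "bit_weight \<Omega> s b K k d =
     \<P>(x in bit_experiment K \<Omega>. fst x = k \<and> s (snd x) \<in> bit_positions b K k d)"

subsection \<open>Complementary error function\<close>

definition erfc :: "ereal \<Rightarrow> real" where
  "erfc x = (case x of
       ereal a \<Rightarrow> 2 / sqrt pi * (LBINT t:{a..}. exp (- (t\<^sup>2)))
     | PInfty \<Rightarrow> 0
     | MInfty \<Rightarrow> 2)"

end

(*
  The k-th bit of the m-th codeword (m counted from 0) is 1 iff (m + L) div (2 L) is even, where
  L = 2^(K-k). Hence the constellation splits into 2^(k-1) + 1 runs of symbols with equal k-th bit:
  the first and the last one have length L, the others 2 L. The decision thresholds are exactly the
  boundaries of these runs, so one run number parametrises the positions of a bit value as well as
  its (disjoint) decision intervals. Conditioning on the transmitted amplitude, which is independent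
  of the noise, then reduces the error probability to Gaussian interval probabilities.
*)

theory Submission
  imports Defs
begin

subsection \<open>Bits of the Gray code\<close>

lemma length_gray: "length (gray K) = 2 ^ K"
  by (induction K) auto

text \<open>Reflection in \<open>{0..<D * a}\<close> maps blocks of length \<open>D\<close> onto
  blocks in reverse order: \<open>D * q + r\<close> goes to block \<open>a - 1 - q\<close> with
  remainder \<open>D - 1 - r\<close>. It serves the reversed half of the Gray code.\<close>

lemma div_reflect:
  fixes D m a :: nat
  assumes "m < D * a"
  shows "(D * a - 1 - m) div D = a - 1 - m div D"
proof -
  define q r where "q = m div D" and "r = m mod D"
  have D: "0 < D" using assms by (cases D) auto
  have m: "m = D * q + r" and r: "r < D" using D by (auto simp: q_def r_def)
  have "q < a" using assms D by (simp add: q_def div_less_iff_less_mult mult.commute)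
  then obtain e where a: "a = Suc (q + e)" using less_imp_Suc_add by blast
  have "D * a - 1 - m = D * e + (D - 1 - r)"
    using r by (simp add: a m algebra_simps)
  also have "\<dots> div D = e" using r by (intro div_nat_eqI) auto
  finally show ?thesis unfolding a q_def[symmetric] by simp
qed

text \<open>Induction on \<open>K\<close>. For \<open>k = 1\<close> the quotient is 0 in the first
  half and 1 in the second. A later bit is bit \<open>k - 1\<close> of the shorter code, and
  \<open>K - k\<close> is unchanged by lowering both numbers; in the second half the index is
  reflected as well, which preserves the parity of the quotient.\<close>

lemma gray_nth:
  assumes "1 \<le> k" "k \<le> K" "m < 2 ^ K"
  shows "gray K ! m ! (k - 1) \<longleftrightarrow> even ((m + 2 ^ (K - k)) div (2 * 2 ^ (K - k)))"
  using assms
proof (induction K arbitrary: k m)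
  case 0
  then show ?case by simp
next
  case (Suc K)
  show ?case
  proof (cases "k = 1")
    case True
    show ?thesis
    proof (cases "m < 2 ^ K")
      case m: True
      then show ?thesis using True by (simp add: nth_append length_gray)
    next
      case False
      then have "(m + 2 ^ K) div (2 * 2 ^ K) = 1"
        using Suc.prems by (intro div_nat_eqI) auto
      then show ?thesis using True False Suc.prems by (simp add: nth_append length_gray)
    qed
  next
    case False
    then obtain k' where k: "k = Suc k'" and k': "1 \<le> k'" "k' \<le> K"
      using Suc.prems by (cases k) auto
    define L :: nat where "L = 2 ^ (K - k')"
    have LK: "2 ^ K = L * 2 ^ k'" using k' by (simp add: L_def flip: power_add)
    have L: "0 < L" by (simp add: L_def)
    show ?thesis
    proof (cases "m < 2 ^ K")
      case m: True
      then show ?thesis using Suc.IH[OF k' m] k' by (simp add: nth_append length_gray k nth_Cons')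
    next
      case m: False
      \<comment> \<open>Index in \<open>gray K\<close> of the codeword that stands, prefixed by 0,
        at place \<open>m\<close> of the reversed half.\<close>
      define m' where "m' = 2 * 2 ^ K - 1 - m"
      have m': "m' < 2 ^ K" "m = 2 * 2 ^ K - 1 - m'" using m Suc.prems by (auto simp: m'_def)
      have "gray (Suc K) ! m ! (k - 1) = gray K ! m' ! (k' - 1)"
        using m Suc.prems k' by (simp add: nth_append length_gray k rev_nth m'_def nth_Cons' mult_2)
      also have "\<dots> = even ((m' + L) div (2 * L))"
        using Suc.IH[OF k' m'(1)] by (simp add: L_def)
      \<comment> \<open>Extending the range by \<open>L\<close> on both sides to length
        \<open>2 * L * (2 ^ k' + 1)\<close>, a whole number of blocks, makes \<open>m' + L\<close>
        the reflection of \<open>m + L\<close>.\<close>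
      also have "(m' + L) div (2 * L) = 2 ^ k' - (m + L) div (2 * L)"
      proof -
        have "m + L < 2 * L * (2 ^ k' + 1)"
          using Suc.prems(3) LK L by (simp add: algebra_simps)
        from div_reflect[OF this]
        have "(2 * L * (2 ^ k' + 1) - 1 - (m + L)) div (2 * L) = 2 ^ k' - (m + L) div (2 * L)"
          by simp
        also have "2 * L * (2 ^ k' + 1) - 1 - (m + L) = m' + L"
          using Suc.prems(3) LK L by (simp add: m'_def algebra_simps)
        finally show ?thesis .
      qed
      \<comment> \<open>\<open>2 ^ k'\<close> is even because \<open>1 \<le> k'\<close>; the bound
        on the quotient keeps the natural subtraction from truncating.\<close>
      also have "even (2 ^ k' - (m + L) div (2 * L)) \<longleftrightarrow> even ((m + L) div (2 * L))"
      proof -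
        have "(m + L) div (2 * L) \<le> 2 ^ k'"
          using Suc.prems(3) LK L by (subst less_Suc_eq_le[symmetric]) (simp add: div_less_iff_less_mult algebra_simps)
        then show ?thesis using k' by (simp add: even_diff_nat)
      qed
      finally show ?thesis by (simp add: L_def k)
    qed
  qed
qed

subsection \<open>Runs of equal bits\<close>

text \<open>
  The bit value is constant on runs of consecutive codewords. The run with number \<open>c\<close> lies between
  the decision thresholds with arguments \<open>c - 1\<close> and \<open>c\<close>, and it carries the bit 1 iff \<open>c\<close> is even;
  both \<open>p_set\<close> and \<open>pbar_set\<close> enumerate the runs with a given bit value.
\<close>

definition runs :: "bool \<Rightarrow> nat \<Rightarrow> nat set" where
  "runs b k = {c. c \<le> 2 ^ (k - 1) \<and> even c = b}"

text \<open>Solves \<open>2 * p + 2 = c\<close> for bit 1 and \<open>2 * p + 3 = c\<close> for bit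
  0, that is, makes \<open>c\<close> the argument of the upper threshold.\<close>

definition p_of :: "bool \<Rightarrow> nat \<Rightarrow> real" where
  "p_of b c = (if b then real c / 2 - 1 else (real c - 3) / 2)"

text \<open>For run 0 the index \<open>-1\<close> would give the threshold argument
  \<open>-1\<close>, which encodes minus infinity. The value \<open>-3/4\<close> gives
  \<open>-1/2\<close> instead, where \<open>Delta_fin\<close> is the finite left edge
  \<open>- (2 ^ K)\<close> of the constellation.\<close>

definition pbar_of :: "bool \<Rightarrow> nat \<Rightarrow> real" where
  "pbar_of b c = (if b \<and> c = 0 then - 3 / 4 else p_of b c)"

text \<open>Start counted from 0, with \<open>L = 2 ^ (K - k)\<close>: the first run takes
  \<open>L\<close> codewords and each of the \<open>c - 1\<close> runs after it takes
  \<open>2 * L\<close>.\<close>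

definition run_start :: "nat \<Rightarrow> nat \<Rightarrow> nat \<Rightarrow> nat" where
  "run_start K k c = (if c = 0 then 0 else (2 * c - 1) * 2 ^ (K - k))"

definition run_size :: "nat \<Rightarrow> nat \<Rightarrow> nat \<Rightarrow> nat" where
  "run_size K k c = (if c = 0 \<or> c = 2 ^ (k - 1) then 2 ^ (K - k) else 2 * 2 ^ (K - k))"

lemma finite_runs [simp]: "finite (runs b k)"
  by (rule finite_subset[of _ "{..2 ^ (k - 1)}"]) (auto simp: runs_def)

lemma inj_on_pbar_of: "inj_on (pbar_of b) (runs b k)"
proof (rule inj_onI)
  fix c c' assume *: "c \<in> runs b k" "c' \<in> runs b k" "pbar_of b c = pbar_of b c'"
  \<comment> \<open>The exceptional value cannot collide with a regular one:
    \<open>c / 2 - 1 = - 3 / 4\<close> would mean \<open>2 * c = 1\<close>.\<close>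
  have "real (2 * c) \<noteq> real 1" for c
    unfolding of_nat_eq_iff by presburger
  then have "real c / 2 - 1 \<noteq> - 3 / 4" for c
    by (auto simp: field_simps)
  then have "c / 2 - 1 \<noteq> - 3 / 4" "- 3 / 4 \<noteq> c / 2 - 1" for c :: nat
    by metis+
  then show "c = c'" using *(3)
    by (cases b; cases "c = 0"; cases "c' = 0") (simp_all add: pbar_of_def p_of_def)
qed

lemma runs_True:
  assumes "1 < k"
  shows "runs True k = (\<lambda>i. nat (2 * i + 2)) ` {-1..2 ^ (k - 2) - 1}"
proof -
  obtain k' where k: "k = Suc (Suc k')" using assms by (intro that[of "k - 2"]) simp
  have "c \<in> (\<lambda>i. nat (2 * i + 2)) ` {-1..2 ^ k' - 1}" if "c \<le> 2 * 2 ^ k'" "even c" for c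
  proof -
    obtain h where h: "c = 2 * h" using \<open>even c\<close> by (auto elim: evenE)
    then have "int h \<le> 2 ^ k'" using that by simp
    then show ?thesis
      by (intro image_eqI[of _ _ "int h - 1"])
        (auto simp: h nat_mult_distrib simp del: of_nat_le_numeral_power_cancel_iff)
  qed
  moreover have "nat (2 * i + 2) \<le> 2 * 2 ^ k' \<and> even (nat (2 * i + 2))" if "-1 \<le> i" "i \<le> 2 ^ k' - 1" for i :: int
    using that by (auto simp: nat_le_iff even_nat_iff)
  ultimately show ?thesis by (auto simp: k runs_def)
qed

lemma runs_False:
  assumes "1 < k"
  shows "runs False k = (\<lambda>i. nat (2 * i + 3)) ` {-1..2 ^ (k - 2) - 2}"
proof -
  obtain k' where k: "k = Suc (Suc k')" using assms by (intro that[of "k - 2"]) simp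
  have "c \<in> (\<lambda>i. nat (2 * i + 3)) ` {-1..2 ^ k' - 2}" if "c \<le> 2 * 2 ^ k'" "odd c" for c
  proof -
    obtain h where h: "c = 2 * h + 1" using \<open>odd c\<close> by (auto elim: oddE)
    have "Suc h \<le> 2 ^ k'" using that h by simp
    then have "int (Suc h) \<le> 2 ^ k'" unfolding of_nat_le_numeral_power_cancel_iff .
    then show ?thesis by (intro image_eqI[of _ _ "int h - 1"]) (auto simp: h nat_add_distrib)
  qed
  moreover have "nat (2 * i + 3) \<le> 2 * 2 ^ k' \<and> odd (nat (2 * i + 3))" if "-1 \<le> i" "i \<le> 2 ^ k' - 2" for i :: int
    using that by (auto simp: nat_le_iff even_nat_iff)
  ultimately show ?thesis by (auto simp: k runs_def)
qed

lemma runs_1: "runs b 1 = (if b then {0} else {1})"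
  by (auto simp: runs_def le_Suc_eq)

lemma p_of_nat:
  "- 1 \<le> i \<Longrightarrow> p_of True (nat (2 * i + 2)) = of_int i"
  "- 1 \<le> i \<Longrightarrow> p_of False (nat (2 * i + 3)) = of_int i"
  by (simp_all add: p_of_def add_divide_distrib)

lemma p_set_eq:
  assumes "1 \<le> k"
  shows "p_set b k = p_of b ` runs b k"
proof (cases "k = 1")
  case True
  then show ?thesis using runs_1[of b] by (simp add: p_set_def p_of_def)
next
  case False
  then have "1 < k" using assms by simp
  then show ?thesis using False
    by (cases b) (auto simp: p_set_def runs_True runs_False image_image p_of_nat intro!: image_cong)
qed

lemma pbar_set_eq:
  assumes "1 \<le> k"
  shows "pbar_set b k = pbar_of b ` runs b k"
proof (cases "b \<and> 1 < k")
  case False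
  then consider "\<not> b" | "b" "k = 1" using assms by linarith
  then show ?thesis
  proof cases
    case 1
    then have "b = False" by simp
    then show ?thesis using assms by (simp add: pbar_set_def p_set_eq pbar_of_def)
  next
    case 2
    then show ?thesis using runs_1[of b] by (simp add: pbar_set_def pbar_of_def)
  qed
next
  case True
  have "- 1 < (2 ^ (k - 2) :: int)"
    using zero_less_power[of "2::int" "k - 2"] by linarith
  \<comment> \<open>The index \<open>-1\<close> belongs to run 0, the only one whose value is
    replaced by \<open>-3/4\<close>.\<close>
  then have split: "{-1..2 ^ (k - 2) - 1} = insert (-1) {0..2 ^ (k - 2) - 1 :: int}"
    by auto
  have "pbar_of True (nat (2 * i + 2)) = of_int i" if "0 \<le> i" for i
    using that by (simp add: pbar_of_def p_of_nat)
  then have "(\<lambda>i. pbar_of True (nat (2 * i + 2))) ` {0..2 ^ (k - 2) - 1} =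
      real_of_int ` {0..2 ^ (k - 2) - 1}"
    by (intro image_cong) auto
  then show ?thesis using True
    by (simp add: pbar_set_def runs_True split image_image) (simp add: pbar_of_def)
qed

section \<open>Thresholds, lengths and amplitudes of the runs\<close>

text \<open>In terms of run numbers the two bit values need no separate treatment. The infinite
  thresholds occur as the lower one of run 0 and the upper one of run
  \<open>2 ^ (k - 1)\<close>.\<close>

lemma delta_p_of:
  "delta_l b (p_of b c) K k = Delta (real c - 1) K k"
  "delta_u b (p_of b c) K k = Delta (real c) K k"
proof -
  have *: "2 * p_of True c + 1 = real c - 1" "2 * p_of True c + 2 = real c"
    "2 * p_of False c + 2 = real c - 1" "2 * p_of False c + 3 = real c"
    by (simp_all add: p_of_def diff_divide_distrib)
  show "delta_l b (p_of b c) K k = Delta (real c - 1) K k"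
    unfolding delta_l_def by (cases b) (simp_all only: * if_True if_False)
  show "delta_u b (p_of b c) K k = Delta (real c) K k"
    unfolding delta_u_def by (cases b) (simp_all only: * if_True if_False)
qed

lemma finite_pbar: "finite (pbar k)"
  by (simp add: pbar_def)

lemma pbar_succ_eqI:
  assumes "y \<in> pbar k" "x < y" "\<And>z. z \<in> pbar k \<Longrightarrow> x < z \<Longrightarrow> y \<le> z"
  shows "pbar_succ k x = y"
  unfolding pbar_succ_def by (rule Min_eqI) (use assms finite_pbar in auto)

lemma pbar_arg:
  "(if b then 2 * pbar_of b c + 1 else 2 * pbar_of b c + 2) =
     (if b \<and> c = 0 then - 1 / 2 else real c - 1)"
  by (simp add: pbar_of_def p_of_def diff_divide_distrib)

text \<open>In units of \<open>d\<close>, the midpoint between the first \<open>m\<close> symbols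
  and the rest is \<open>2 * m - 2 ^ K\<close>. So, with \<open>L = 2 ^ (K - k)\<close>, the
  threshold with argument \<open>x\<close> comes after \<open>(2 * x + 1) * L\<close> symbols; for
  \<open>x = c - 1\<close> and \<open>c > 0\<close> this is \<open>run_start K k c\<close>.\<close>

lemma Delta_fin_eq:
  assumes "1 \<le> k" "k \<le> K"
  shows "Delta_fin x K k = 2 * 2 ^ (K - k) * (1 + 2 * x) - 2 ^ K"
proof -
  have "(2::real) ^ K = 2 * 2 ^ (K - k) * 2 ^ (k - 1)"
    using assms by (simp flip: power_add power_Suc)
  then show ?thesis by (simp add: Delta_fin_def field_simps)
qed

lemma pbar_iff:
  "z \<in> pbar k \<longleftrightarrow> z = - 1 / 2 \<or> z = real (2 ^ (k - 1)) - 1 / 2 \<or> (\<exists>i<2 ^ (k - 1). z = real i)"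
  by (auto simp: pbar_def)

lemma pbar_succ_first: "pbar_succ k (- 1 / 2) = 0"
proof (rule pbar_succ_eqI)
  have N: "0 < (2 ^ (k - 1) :: nat)" by simp
  then show "0 \<in> pbar k" unfolding pbar_iff by (metis of_nat_0)
  have "1 \<le> real (2 ^ (k - 1))" by simp
  then show "0 \<le> z" if "z \<in> pbar k" "- 1 / 2 < z" for z
    using that unfolding pbar_iff by (elim disjE exE conjE) linarith+
qed simp

lemma pbar_succ_of_nat:
  assumes "Suc i < 2 ^ (k - 1)"
  shows "pbar_succ k (real i) = real (Suc i)"
proof (rule pbar_succ_eqI)
  show "real (Suc i) \<in> pbar k" unfolding pbar_iff using assms by blast
  show "real (Suc i) \<le> z" if z: "z \<in> pbar k" "real i < z" for z
  proof -
    \<comment> \<open>Places the half-integer last element of \<open>pbar k\<close> above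
      \<open>Suc i\<close>.\<close>
    have "Suc (Suc i) \<le> 2 ^ (k - 1)" using assms by (rule Suc_leI)
    then have "real (Suc (Suc i)) \<le> real (2 ^ (k - 1))" by (rule of_nat_mono)
    then show ?thesis using z unfolding pbar_iff
    proof (elim disjE exE conjE)
      fix h assume "z = real h"
      then have "Suc i \<le> h" using z(2) by simp
      then show ?thesis unfolding \<open>z = real h\<close> by (rule of_nat_mono)
    qed linarith+
  qed
qed simp

lemma pbar_succ_last:
  assumes "2 ^ (k - 1) = Suc i"
  shows "pbar_succ k (real i) = real i + 1 / 2"
proof (rule pbar_succ_eqI)
  show "real i + 1 / 2 \<in> pbar k" unfolding pbar_iff assms by simp
  show "real i + 1 / 2 \<le> z" if z: "z \<in> pbar k" "real i < z" for z
    using z unfolding pbar_iff assms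
  proof (elim disjE exE conjE)
    fix h assume "h < Suc i" "z = real h"
    then show ?thesis using z(2) by simp
  qed auto
qed simp

text \<open>\<open>Delta_fin\<close> is affine in its argument with slope
  \<open>4 * 2 ^ (K - k)\<close>. The gaps in \<open>pbar k\<close> are 1/2 at both ends and 1
  elsewhere, which yields the half-length outer runs; the factor 2 is the symbol spacing.\<close>

lemma run_length_pbar_of:
  assumes "1 \<le> k" "k \<le> K" "c \<in> runs b k"
  shows "run_length (if b then 2 * pbar_of b c + 1 else 2 * pbar_of b c + 2) K k = 2 * real (run_size K k c)"
proof -
  let ?x = "if b \<and> c = 0 then - 1 / 2 else real c - 1"
  have c: "c \<le> 2 ^ (k - 1)" "b \<longleftrightarrow> even c" using assms by (auto simp: runs_def)
  have succ: "pbar_succ k ?x = ?x + (if c = 0 \<or> c = 2 ^ (k - 1) then 1/2 else 1)"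
  proof (cases c)
    case 0
    then show ?thesis using c(2) pbar_succ_first by simp
  next
    case (Suc i)
    show ?thesis
    proof (cases "c = 2 ^ (k - 1)")
      case True
      then have "pbar_succ k (real i) = real i + 1 / 2" using Suc by (intro pbar_succ_last) simp
      then show ?thesis unfolding True[symmetric] by (simp add: Suc)
    next
      case False
      then have "pbar_succ k (real i) = real (Suc i)" using c(1) Suc by (intro pbar_succ_of_nat) simp
      then show ?thesis using False by (simp add: Suc)
    qed
  qed
  have "Delta_fin (x + e) K k - Delta_fin x K k = 4 * 2 ^ (K - k) * e" for x e
    using assms by (simp add: Delta_fin_eq algebra_simps)
  then show ?thesis unfolding pbar_arg run_length_def succ by (simp add: run_size_def)
qed

lemma j_set_pbar_of:
  assumes "1 \<le> k" "k \<le> K" "c \<in> runs b k"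
  shows "j_set b (pbar_of b c) K k = {..<run_size K k c}"
proof -
  have "real j \<le> 2 * real N / 2 - 1 \<longleftrightarrow> real (Suc j) \<le> real N" for j N
    by auto
  then show ?thesis unfolding j_set_def run_length_pbar_of[OF assms] of_nat_le_iff by auto
qed

lemma A_val_pbar_of:
  assumes "1 \<le> k" "k \<le> K" "c \<in> runs b k"
  shows "A_val b (pbar_of b c) j K k * d = amplitude (2 ^ K) d (Suc (run_start K k c + j))"
proof -
  \<comment> \<open>Run 0 carries bit 1, so the exceptional argument \<open>- 1 / 2\<close> applies
    whenever \<open>c = 0\<close>.\<close>
  have "c = 0 \<Longrightarrow> b" using assms by (auto simp: runs_def)
  then show ?thesis using assms
    by (cases c) (auto simp: A_val_def pbar_arg Delta_fin_eq amplitude_def run_start_def algebra_simps)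
qed

section \<open>Sums over the positions of a bit value\<close>

text \<open>Counted from 0 like list positions, whereas \<open>amplitude\<close> counts from 1; this
  accounts for the \<open>Suc\<close> in the lemmas that link them.\<close>

definition codeword_indices :: "bool \<Rightarrow> nat \<Rightarrow> nat \<Rightarrow> nat set" where
  "codeword_indices b K k = {m. m < 2 ^ K \<and> gray K ! m ! (k - 1) = b}"

lemma bit_positions_eq:
  "bit_positions b K k d = (\<lambda>m. amplitude (2 ^ K) d (Suc m)) ` codeword_indices b K k"
proof -
  have "i \<in> Suc ` codeword_indices b K k" if "i \<in> {1..2 ^ K}" "gray K ! (i - 1) ! (k - 1) = b" for i
    using that by (intro image_eqI[of _ _ "i - 1"]) (auto simp: codeword_indices_def)
  then show ?thesis
    by (fastforce simp: bit_positions_def codeword_indices_def)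
qed

text \<open>An index \<open>m\<close> corresponds to the pair of its run number
  \<open>c = (m + L) div (2 * L)\<close> and its offset from the start of that run, and
  \<open>gray_nth\<close> reads the bit off the parity of \<open>c\<close>.\<close>

lemma sum_codeword_indices:
  assumes "1 \<le> k" "k \<le> K"
  shows "(\<Sum>m\<in>codeword_indices b K k. f m) =
         (\<Sum>c\<in>runs b k. \<Sum>j<run_size K k c. f (run_start K k c + j))"
proof -
  define L :: nat where "L = 2 ^ (K - k)"
  define N :: nat where "N = 2 ^ (k - 1)"
  have L: "0 < L" and N: "0 < N" by (auto simp: L_def N_def)
  have KL: "2 ^ K = 2 * L * N" using assms by (simp add: L_def N_def flip: power_add power_Suc)
  have idx: "codeword_indices b K k = {m. m < 2 * L * N \<and> even ((m + L) div (2 * L)) = b}"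
    unfolding KL[symmetric] unfolding codeword_indices_def L_def using gray_nth[OF assms] by auto
  have rstart: "run_start K k c = (if c = 0 then 0 else (2 * c - 1) * L)"
    and rsize: "run_size K k c = (if c = 0 \<or> c = N then L else 2 * L)" for c
    by (simp_all add: run_start_def run_size_def L_def N_def)
  have run: "(run_start K k c + j + L) div (2 * L) = c \<and> run_start K k c + j < 2 * L * N"
    if c: "c \<le> N" and j: "j < run_size K k c" for c j
  proof (cases "c = 0")
    case True
    then have "j < L" using j by (simp add: rsize)
    moreover have "L * 1 \<le> L * N" using N by (intro mult_le_mono2) simp
    ultimately have "j < 2 * (L * N)" by linarith
    then show ?thesis using True \<open>j < L\<close> by (simp add: rstart mult.assoc)
  next
    case False
    then obtain e where e: "c = Suc e" by (cases c) auto
    have s: "run_start K k c = 2 * L * e + L" by (simp add: rstart e algebra_simps)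
    have j2: "j < 2 * L" "c = N \<Longrightarrow> j < L"
      using j L by (auto simp: rsize e split: if_splits)
    have shift: "run_start K k c + j + L = 2 * L * c + j" unfolding s by (simp add: e algebra_simps)
    have "(run_start K k c + j + L) div (2 * L) = c" unfolding shift using j2 L by simp
    moreover have "run_start K k c + j < 2 * L * N"
    proof (cases "c = N")
      case True
      then show ?thesis using j2 L unfolding s True[symmetric] by (simp add: e algebra_simps)
    next
      case False
      then obtain g where g: "N = c + Suc g" using c less_imp_Suc_add[of c N] by auto
      show ?thesis using j2 L unfolding s g by (simp add: e algebra_simps)
    qed
    ultimately show ?thesis by simp
  qed
  have "(\<Sum>c\<in>runs b k. \<Sum>j<run_size K k c. f (run_start K k c + j)) =
        (\<Sum>(c, j)\<in>(SIGMA c:runs b k. {..<run_size K k c}). f (run_start K k c + j))"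
    by (rule sum.Sigma) auto
  also have "\<dots> = (\<Sum>m\<in>codeword_indices b K k. f m)"
  proof (rule sum.reindex_bij_witness[where j = "\<lambda>(c, j). run_start K k c + j" and
        i = "\<lambda>m. ((m + L) div (2 * L), m - run_start K k ((m + L) div (2 * L)))"])
    fix x assume "x \<in> (SIGMA c:runs b k. {..<run_size K k c})"
    then obtain c j where x: "x = (c, j)" "c \<in> runs b k" "j < run_size K k c" by auto
    note r = run[of c j]
    have c: "c \<le> N" "even c = b" using x by (auto simp: runs_def N_def)
    show "(\<lambda>m. ((m + L) div (2 * L), m - run_start K k ((m + L) div (2 * L))))
           (case x of (c, j) \<Rightarrow> run_start K k c + j) = x"
      using r x c by simp
    show "(case x of (c, j) \<Rightarrow> run_start K k c + j) \<in> codeword_indices b K k"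
      using r x c by (simp add: idx)
  next
    fix m assume m: "m \<in> codeword_indices b K k"
    define c where "c = (m + L) div (2 * L)"
    define h where "h = (m + L) mod (2 * L)"
    have mK: "m < 2 * L * N" and bc: "even c = b"
      using m by (simp_all add: idx c_def)
    have mc: "m + L = 2 * L * c + h" "h < 2 * L" using L by (auto simp: c_def h_def)
    \<comment> \<open>A larger quotient would give \<open>m + L \<ge> 2 * L * (N + 1)\<close>,
      contrary to \<open>m < 2 * L * N\<close>.\<close>
    have cN: "c \<le> N"
    proof (rule ccontr)
      assume "\<not> c \<le> N"
      then have "2 * L * Suc N \<le> 2 * L * c" by (intro mult_le_mono2) simp
      then show False using mc mK L by simp
    qed
    have *: "run_start K k c \<le> m \<and> m - run_start K k c < run_size K k c"
    proof (cases "c = 0")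
      case True
      then show ?thesis using mc by (simp add: rstart rsize)
    next
      case False
      then obtain e where e: "c = Suc e" by (cases c) auto
      have s: "run_start K k c = 2 * L * e + L" by (simp add: rstart e algebra_simps)
      have "m = run_start K k c + h" using mc s e by (simp add: algebra_simps)
      \<comment> \<open>The end of the constellation cuts the last run in half.\<close>
      moreover have "h < L" if "c = N" using mc mK that by simp
      ultimately show ?thesis using mc by (auto simp: rsize)
    qed
    show "(case ((m + L) div (2 * L), m - run_start K k ((m + L) div (2 * L))) of
           (c, j) \<Rightarrow> run_start K k c + j) = m"
      using * by (simp add: c_def[symmetric])
    show "((m + L) div (2 * L), m - run_start K k ((m + L) div (2 * L)))
          \<in> (SIGMA c:runs b k. {..<run_size K k c})"
      using * cN bc by (simp add: c_def[symmetric] runs_def N_def)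
  qed auto
  finally show ?thesis ..
qed

lemma finite_codeword_indices [simp]: "finite (codeword_indices b K k)"
  by (rule finite_subset[of _ "{..<2 ^ K}"]) (auto simp: codeword_indices_def)

lemma inj_amplitude: "d \<noteq> 0 \<Longrightarrow> inj (amplitude M d)"
  by (rule injI) (simp add: amplitude_def)

text \<open>Three reindexings: amplitudes by codeword indices, injectively since
  \<open>d \<noteq> 0\<close>; indices by runs and offsets; runs by \<open>pbar_of\<close>, which is
  injective on them.\<close>

lemma sum_bit_positions:
  assumes "1 \<le> k" "k \<le> K" "d \<noteq> 0"
  shows "(\<Sum>a\<in>bit_positions b K k d. f a) =
         (\<Sum>q\<in>pbar_set b k. \<Sum>j\<in>j_set b q K k. f (A_val b q j K k * d))"
proof -
  have "(\<Sum>a\<in>bit_positions b K k d. f a) =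
        (\<Sum>m\<in>codeword_indices b K k. f (amplitude (2 ^ K) d (Suc m)))"
    unfolding bit_positions_eq
    by (rule sum.reindex[unfolded o_def]) (meson Suc_inject assms(3) inj_amplitude injD inj_onI)
  also have "\<dots> = (\<Sum>c\<in>runs b k. \<Sum>j\<in>j_set b (pbar_of b c) K k. f (A_val b (pbar_of b c) j K k * d))"
    unfolding sum_codeword_indices[OF assms(1,2)] using assms
    by (intro sum.cong refl) (simp_all add: j_set_pbar_of A_val_pbar_of)
  also have "\<dots> = (\<Sum>q\<in>pbar_set b k. \<Sum>j\<in>j_set b q K k. f (A_val b q j K k * d))"
    unfolding pbar_set_eq[OF assms(1)] by (subst sum.reindex) (simp_all add: inj_on_pbar_of)
  finally show ?thesis .
qed

subsection \<open>Decision intervals and Gaussian noise\<close>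

text \<open>The infinite values sit exactly at the two ends of the range of arguments, so they
  respect the order of the affine part.\<close>

lemma Delta_mono:
  assumes "1 \<le> k" "k \<le> K" "- 1 \<le> x" "x \<le> y" "y \<le> 2 ^ (k - 1)"
  shows "Delta x K k \<le> Delta y K k"
proof -
  have "Delta_fin x K k \<le> Delta_fin y K k"
    using assms by (simp add: Delta_fin_eq)
  then show ?thesis using assms by (auto simp: Delta_def)
qed

lemma finite_p_set: "finite (p_set b k)"
  by (simp add: p_set_def)

lemma finite_regions: "finite (regions b K k d)"
  by (simp add: regions_def finite_p_set)

lemma delta_l_le_delta_u:
  assumes "1 \<le> k" "k \<le> K" "p \<in> p_set b k"
  shows "delta_l b p K k \<le> delta_u b p K k"
proof -
  obtain c where c: "p = p_of b c" "c \<le> 2 ^ (k - 1)"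
    using assms by (auto simp: p_set_eq runs_def)
  have "real c \<le> real (2 ^ (k - 1))" using c(2) by (rule of_nat_mono)
  then show ?thesis unfolding c(1) delta_p_of using assms by (intro Delta_mono) auto
qed

lemma decision_intervals_disjoint:
  fixes r :: ereal
  assumes k: "1 \<le> k" "k \<le> K" and "0 < d" and p: "p \<in> p_set b k" "q \<in> p_set b k"
    and r: "delta_l b p K k * ereal d \<le> r" "r < delta_u b p K k * ereal d"
      "delta_l b q K k * ereal d \<le> r" "r < delta_u b q K k * ereal d"
  shows "p = q"
proof -
  obtain c e where c: "p = p_of b c" "c \<le> 2 ^ (k - 1)" and e: "q = p_of b e" "e \<le> 2 ^ (k - 1)"
    using k p by (auto simp: p_set_eq runs_def)
  \<comment> \<open>As \<open>i \<le> j - 1\<close>, the upper threshold of run \<open>i\<close> is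
    at most the lower one of run \<open>j\<close>, so \<open>r\<close> cannot lie below the former
    and not below the latter.\<close>
  have *: False if "i < j" "j \<le> 2 ^ (k - 1)" "r < Delta (real i) K k * ereal d"
    "Delta (real j - 1) K k * ereal d \<le> r" for i j
  proof -
    have "real j - 1 \<le> 2 ^ (k - 1)"
      using of_nat_mono[OF that(2), where 'a = real] by (simp del: of_nat_le_numeral_power_cancel_iff)
    moreover have "real (Suc i) \<le> real j" using that(1) by (intro of_nat_mono) simp
    ultimately have "Delta (real i) K k \<le> Delta (real j - 1) K k"
      using k by (intro Delta_mono) auto
    then have "Delta (real i) K k * ereal d \<le> Delta (real j - 1) K k * ereal d"
      using \<open>0 < d\<close> by (intro ereal_mult_right_mono) auto
    then show False using that by simp
  qed
  have "\<not> c < e" "\<not> e < c"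
    using *[of c e] *[of e c] c e r by (auto simp: delta_p_of)
  then show ?thesis using c e by simp
qed

text \<open>The event is a finite union of interval events, and the decision intervals are disjoint,
  so probabilities add.\<close>

lemma (in prob_space) prob_in_regions:
  assumes "1 \<le> k" "k \<le> K" "0 < d" and [measurable]: "random_variable borel X"
  shows "\<P>(\<omega> in M. X \<omega> \<odot> regions b K k d) =
    (\<Sum>p\<in>p_set b k. \<P>(\<omega> in M. delta_l b p K k * ereal d \<le> ereal (X \<omega>) \<and>
      ereal (X \<omega>) < delta_u b p K k * ereal d))"
proof -
  define E where "E p = {\<omega> \<in> space M. delta_l b p K k * ereal d \<le> ereal (X \<omega>) \<and>
    ereal (X \<omega>) < delta_u b p K k * ereal d}" for p
  have union: "{\<omega> \<in> space M. X \<omega> \<odot> regions b K k d} = (\<Union>p\<in>p_set b k. E p)"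
    unfolding E_def in_regions_def regions_def by blast
  have E: "E p \<in> events" for p
    unfolding E_def by measurable
  have "disjoint_family_on E (p_set b k)"
    unfolding disjoint_family_on_def E_def using decision_intervals_disjoint[OF assms(1-3)] by blast
  then have "prob (\<Union>p\<in>p_set b k. E p) = (\<Sum>p\<in>p_set b k. prob (E p))"
    using E finite_p_set by (intro finite_measure_finite_Union) auto
  then show ?thesis unfolding union unfolding E_def .
qed

section \<open>Gaussian tails and intervals\<close>

lemma erfc_infinity [simp]: "erfc \<infinity> = 0" "erfc (- \<infinity>) = 2"
  unfolding erfc_def infinity_ereal_def uminus_ereal.simps ereal.case by (rule refl)+

lemma (in prob_space) prob_normal_ge:
  assumes "0 < N0" and n: "distributed M lborel n (normal_density 0 (sqrt (N0 / 2)))"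
  shows "\<P>(\<omega> in M. x \<le> n \<omega>) = erfc (ereal (x / sqrt N0)) / 2"
proof -
  have [measurable]: "random_variable borel n"
    using distributed_measurable[OF n] by simp
  have "\<P>(\<omega> in M. x \<le> n \<omega>) = (\<integral>\<omega>. indicator {x..} (n \<omega>) \<partial>M)"
  proof -
    have "(\<integral>\<omega>. indicator {x..} (n \<omega>) \<partial>M) = (\<integral>\<omega>. indicator {\<omega> \<in> space M. x \<le> n \<omega>} \<omega> \<partial>M :: real)"
      by (intro Bochner_Integration.integral_cong) (auto simp: indicator_def)
    then show ?thesis by simp
  qed
  also have "\<dots> = (\<integral>y. normal_density 0 (sqrt (N0 / 2)) y * indicator {x..} y \<partial>lborel)"
    by (rule distributed_integral[OF n, symmetric]) auto
  \<comment> \<open>The substitution \<open>y = sqrt N0 * t\<close> turns the exponent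
    \<open>y * y / N0\<close>, coming from the variance \<open>N0 / 2\<close>, into
    \<open>t * t\<close>.\<close>
  also have "\<dots> = sqrt N0 * (\<integral>t. normal_density 0 (sqrt (N0 / 2)) (sqrt N0 * t) * indicator {x..} (sqrt N0 * t) \<partial>lborel)"
    using \<open>0 < N0\<close> by (subst lborel_integral_real_affine[where c = "sqrt N0" and t = 0]) auto
  also have "(\<lambda>t. normal_density 0 (sqrt (N0 / 2)) (sqrt N0 * t) * indicator {x..} (sqrt N0 * t)) =
      (\<lambda>t. 1 / sqrt (pi * N0) * (indicator {x / sqrt N0..} t *\<^sub>R exp (- (t\<^sup>2))))"
    using \<open>0 < N0\<close>
    by (intro ext) (auto simp: normal_density_def indicator_def field_simps power_mult_distrib)
  also have "sqrt N0 * (\<integral>t. 1 / sqrt (pi * N0) * (indicator {x / sqrt N0..} t *\<^sub>R exp (- (t\<^sup>2))) \<partial>lborel)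
      = 1 / sqrt pi * (LBINT t:{x / sqrt N0..}. exp (- (t\<^sup>2)))"
    using \<open>0 < N0\<close> unfolding set_lebesgue_integral_def
    by (subst integral_mult_right_zero) (simp add: real_sqrt_mult)
  finally show ?thesis by (simp add: erfc_def)
qed

lemma (in prob_space) prob_normal_interval:
  assumes "0 < N0" "0 < d" "l \<le> u"
    and n: "distributed M lborel n (normal_density 0 (sqrt (N0 / 2)))"
  shows "\<P>(\<omega> in M. l * ereal d \<le> ereal (a * d + n \<omega>) \<and> ereal (a * d + n \<omega>) < u * ereal d) =
    (erfc (ereal (d / sqrt N0) * (l - ereal a)) - erfc (ereal (d / sqrt N0) * (u - ereal a))) / 2"
proof -
  have [measurable]: "random_variable borel n"
    using distributed_measurable[OF n] by simp
  \<comment> \<open>Thresholds may be infinite: at minus infinity, probability 1 matches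
    \<open>erfc = 2\<close>; at infinity, both sides vanish.\<close>
  have tail: "\<P>(\<omega> in M. x * ereal d \<le> ereal (a * d + n \<omega>)) = erfc (ereal (d / sqrt N0) * (x - ereal a)) / 2"
    for x
  proof (cases x)
    case (real y)
    have "\<P>(\<omega> in M. x * ereal d \<le> ereal (a * d + n \<omega>)) = \<P>(\<omega> in M. (y - a) * d \<le> n \<omega>)"
      by (simp add: real algebra_simps)
    also have "\<dots> = erfc (ereal ((y - a) * d / sqrt N0)) / 2"
      by (rule prob_normal_ge[OF \<open>0 < N0\<close> n])
    finally show ?thesis by (simp add: real mult.commute)
  next
    case PInf
    then show ?thesis using \<open>0 < d\<close> \<open>0 < N0\<close> by simp
  next
    case MInf
    then show ?thesis using \<open>0 < d\<close> \<open>0 < N0\<close> by (simp add: prob_space)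
  qed
  have "l * ereal d \<le> u * ereal d"
    using \<open>0 < d\<close> \<open>l \<le> u\<close> by (intro ereal_mult_right_mono) auto
  then have "\<P>(\<omega> in M. l * ereal d \<le> ereal (a * d + n \<omega>) \<and> ereal (a * d + n \<omega>) < u * ereal d) =
      measure M ({\<omega> \<in> space M. l * ereal d \<le> ereal (a * d + n \<omega>)} - {\<omega> \<in> space M. u * ereal d \<le> ereal (a * d + n \<omega>)})"
    by (intro arg_cong[where f = "measure M"]) auto
  also have "\<dots> = \<P>(\<omega> in M. l * ereal d \<le> ereal (a * d + n \<omega>)) - \<P>(\<omega> in M. u * ereal d \<le> ereal (a * d + n \<omega>))"
    using \<open>l * ereal d \<le> u * ereal d\<close> by (intro finite_measure_Diff) (auto intro: order_trans)
  finally show ?thesis unfolding tail by simp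
qed

section \<open>Independence of symbol, noise and inspected bit\<close>

text \<open>Splitting by the value of \<open>s\<close> gives disjoint events, each a rectangle in
  \<open>(s, n)\<close> whose probability factorises by independence.\<close>

lemma (in prob_space) prob_discrete_plus_noise:
  assumes indep: "indep_var borel s borel n" and "finite A"
    and meas: "\<And>a. a \<in> A \<Longrightarrow> {x. a + x \<odot> R} \<in> sets borel"
  shows "\<P>(\<omega> in M. s \<omega> \<in> A \<and> s \<omega> + n \<omega> \<odot> R) =
    (\<Sum>a\<in>A. \<P>(\<omega> in M. s \<omega> = a) * \<P>(\<omega> in M. a + n \<omega> \<odot> R))"
proof -
  have [measurable]: "random_variable borel s" "random_variable borel n"
    using indep by (blast dest: indep_var_rv1 indep_var_rv2)+
  let ?E = "\<lambda>a. (\<lambda>\<omega>. (s \<omega>, n \<omega>)) -` ({a} \<times> {x. a + x \<odot> R}) \<inter> space M"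
  have E: "?E a \<in> events" if "a \<in> A" for a
    using meas[OF that] by (intro measurable_sets[of _ _ "borel \<Otimes>\<^sub>M borel"]) auto
  have "{\<omega> \<in> space M. s \<omega> \<in> A \<and> s \<omega> + n \<omega> \<odot> R} = (\<Union>a\<in>A. ?E a)"
    by auto
  also have "prob \<dots> = (\<Sum>a\<in>A. prob (?E a))"
    using E \<open>finite A\<close> by (intro finite_measure_finite_Union) (auto simp: disjoint_family_on_def)
  also have "\<dots> = (\<Sum>a\<in>A. prob (s -` {a} \<inter> space M) * prob (n -` {x. a + x \<odot> R} \<inter> space M))"
    using meas by (intro sum.cong indep_varD[OF indep]) auto
  finally show ?thesis
    by (simp add: vimage_def Collect_conj_eq[symmetric] Int_def conj_commute)
qed

text \<open>The event is a rectangle in the product measure, with first side \<open>{k}\<close> of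
  mass \<open>1 / K\<close>.\<close>

lemma (in prob_space) prob_bit_experiment:
  assumes "k \<in> {1..K}" and Q: "{\<omega> \<in> space M. Q \<omega>} \<in> events"
  shows "\<P>(x in bit_experiment K M. fst x = k \<and> Q (snd x)) = \<P>(\<omega> in M. Q \<omega>) / real K"
proof -
  have "{x \<in> space (bit_experiment K M). fst x = k \<and> Q (snd x)} = {k} \<times> {\<omega> \<in> space M. Q \<omega>}"
    by (auto simp: bit_experiment_def space_pair_measure)
  then have "\<P>(x in bit_experiment K M. fst x = k \<and> Q (snd x)) =
      measure (measure_pmf (pmf_of_set {1..K})) {k} * \<P>(\<omega> in M. Q \<omega>)"
    using Q by (simp add: bit_experiment_def measure_def emeasure_pair_measure_Times enn2real_mult)
  also have "measure (measure_pmf (pmf_of_set {1..K})) {k} = 1 / real K"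
    using assms by (simp add: measure_pmf_single)
  finally show ?thesis by simp
qed


lemma sets_in_regions:
  assumes "finite R"
  shows "{x. a + x \<odot> R} \<in> sets borel"
proof -
  have "{x. a + x \<odot> R} = (\<Union>(l, u)\<in>R. {x. l \<le> ereal (a + x) \<and> ereal (a + x) < u})"
    by (auto simp: in_regions_def)
  also have "\<dots> \<in> sets borel"
    using assms by (intro sets.finite_UN) (auto split: prod.split)
  finally show ?thesis .
qed

text \<open>A nonzero \<open>d\<close> makes \<open>amplitude\<close> injective, so a position
  determines its codeword and hence the bit.\<close>

lemma disjoint_bit_positions:
  assumes "d \<noteq> 0" "a \<in> bit_positions b K k d" "a \<in> bit_positions c K k d"
  shows "b = c"
  using assms injD[OF inj_amplitude[OF assms(1)]] unfolding bit_positions_def by blast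

lemma finite_bit_positions: "finite (bit_positions b K k d)"
  by (simp add: bit_positions_eq)

text \<open>In the first equality each conditional probability is weighted by the probability that
  the \<open>k\<close>-th bit is inspected and has the conditioning value, so that the products are
  joint probabilities.\<close>

theorem mainTheorem2:
  fixes M K k :: nat and Eb N0 d :: real
    and \<Omega> :: "'w measure" and s n :: "'w \<Rightarrow> real"
  assumes "0 < M" and "real K = log 2 (real M)" and "1 \<le> K"
    and "1 \<le> k" and "k \<le> K"
    and "0 < Eb" and "0 < N0"
    and "d = sqrt (3 * log 2 (real M) * Eb / ((real M)\<^sup>2 - 1))"
    and "prob_space \<Omega>"
    and "prob_space.indep_var \<Omega> borel s borel n"
    and "\<forall>i\<in>{1..M}. \<P>(\<omega> in \<Omega>. s \<omega> = amplitude M d i) = 1 / real M"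
    and "distributed \<Omega> lborel n (normal_density 0 (sqrt (N0 / 2)))"
  shows
    "P_PAM \<Omega> s n K k d =
       bit_weight \<Omega> s False K k d *
         \<P>(\<omega> in \<Omega>. (s \<omega> + n \<omega>) \<odot> regions True K k d \<bar> s \<omega> \<in> bit_positions False K k d)
     + bit_weight \<Omega> s True K k d *
         \<P>(\<omega> in \<Omega>. (s \<omega> + n \<omega>) \<odot> regions False K k d \<bar> s \<omega> \<in> bit_positions True K k d)
   \<and> P_PAM \<Omega> s n K k d =
       1 / (real M * real K) *
         ((\<Sum>a\<in>bit_positions False K k d. \<P>(\<omega> in \<Omega>. (a + n \<omega>) \<odot> regions True K k d))
        + (\<Sum>a\<in>bit_positions True K k d. \<P>(\<omega> in \<Omega>. (a + n \<omega>) \<odot> regions False K k d)))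
   \<and> P_PAM \<Omega> s n K k d =
       1 / (real M * real K) *
         ((\<Sum>q\<in>pbar_set False k. \<Sum>j\<in>j_set False q K k. \<Sum>p\<in>p_set True k.
             \<P>(\<omega> in \<Omega>. delta_l True p K k * ereal d \<le> ereal (A_val False q j K k * d + n \<omega>)
                    \<and> ereal (A_val False q j K k * d + n \<omega>) < delta_u True p K k * ereal d))
        + (\<Sum>q\<in>pbar_set True k. \<Sum>j\<in>j_set True q K k. \<Sum>p\<in>p_set False k.
             \<P>(\<omega> in \<Omega>. delta_l False p K k * ereal d \<le> ereal (A_val True q j K k * d + n \<omega>)
                    \<and> ereal (A_val True q j K k * d + n \<omega>) < delta_u False p K k * ereal d)))
   \<and> P_PAM \<Omega> s n K k d =
       1 / (2 * real M * real K) *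
         ((\<Sum>q\<in>pbar_set False k. \<Sum>j\<in>j_set False q K k. \<Sum>p\<in>p_set True k.
             erfc (ereal (d / sqrt N0) * (delta_l True p K k - ereal (A_val False q j K k)))
           - erfc (ereal (d / sqrt N0) * (delta_u True p K k - ereal (A_val False q j K k))))
        + (\<Sum>q\<in>pbar_set True k. \<Sum>j\<in>j_set True q K k. \<Sum>p\<in>p_set False k.
             erfc (ereal (d / sqrt N0) * (delta_l False p K k - ereal (A_val True q j K k)))
           - erfc (ereal (d / sqrt N0) * (delta_u False p K k - ereal (A_val True q j K k)))))"
proof -
  interpret prob_space \<Omega> by fact
  note indep = assms(10) and normal = assms(12)
  have [measurable]: "random_variable borel s" "random_variable borel n"
    using indep by (blast dest: indep_var_rv1 indep_var_rv2)+
  have k: "1 \<le> k" "k \<le> K" by fact+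
  have "real M = 2 powr real K" using assms(1,2) by simp
  then have "real M = real (2 ^ K)" by (simp add: powr_realpow)
  then have M: "M = 2 ^ K" by (simp only: of_nat_eq_iff)
  \<comment> \<open>Makes the denominator \<open>M * M - 1\<close> under the root positive;
    \<open>0 < d\<close> then gives distinct amplitudes and correctly ordered intervals.\<close>
  have "2 ^ 1 \<le> M" unfolding M using \<open>1 \<le> K\<close> by (intro power_increasing) auto
  then have "0 < (real M)\<^sup>2 - 1" by simp
  moreover have "0 < log 2 (real M)" using assms(2,3) by linarith
  ultimately have d: "0 < d" unfolding assms(8) using \<open>0 < Eb\<close> by simp
  have [measurable]: "Measurable.pred borel (\<lambda>x. x \<in> bit_positions b K k d)" for b
    using finite_bit_positions[of b K k d] by (simp add: borel_closed finite_imp_closed pred_def)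

  \<comment> \<open>All quantities are indexed by the transmitted bit value \<open>b\<close>, so
    that both halves of the formula are treated at once.\<close>
  define J where "J b = \<P>(\<omega> in \<Omega>. s \<omega> \<in> bit_positions b K k d \<and> s \<omega> + n \<omega> \<odot> regions (\<not> b) K k d)" for b
  define S where "S b = \<P>(\<omega> in \<Omega>. s \<omega> \<in> bit_positions b K k d)" for b
  define P2 where "P2 b = (\<Sum>a\<in>bit_positions b K k d. \<P>(\<omega> in \<Omega>. a + n \<omega> \<odot> regions (\<not> b) K k d))" for b
  define P3 where "P3 b = (\<Sum>q\<in>pbar_set b k. \<Sum>j\<in>j_set b q K k. \<Sum>p\<in>p_set (\<not> b) k.
             \<P>(\<omega> in \<Omega>. delta_l (\<not> b) p K k * ereal d \<le> ereal (A_val b q j K k * d + n \<omega>)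
                    \<and> ereal (A_val b q j K k * d + n \<omega>) < delta_u (\<not> b) p K k * ereal d))" for b
  define P4 where "P4 b = (\<Sum>q\<in>pbar_set b k. \<Sum>j\<in>j_set b q K k. \<Sum>p\<in>p_set (\<not> b) k.
             erfc (ereal (d / sqrt N0) * (delta_l (\<not> b) p K k - ereal (A_val b q j K k)))
           - erfc (ereal (d / sqrt N0) * (delta_u (\<not> b) p K k - ereal (A_val b q j K k))))" for b

  have meas: "{\<omega> \<in> space \<Omega>. s \<omega> \<in> bit_positions b K k d \<and> s \<omega> + n \<omega> \<odot> regions c K k d} \<in> events" for b c
  proof -
    have [measurable]: "{x. x \<odot> regions c K k d} \<in> sets borel"
      using sets_in_regions[OF finite_regions, of 0] by simp
    have "{\<omega> \<in> space \<Omega>. s \<omega> \<in> bit_positions b K k d \<and> s \<omega> + n \<omega> \<in> {x. x \<odot> regions c K k d}} \<in> events"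
      by measurable
    then show ?thesis by simp
  qed
  have meas_S: "{\<omega> \<in> space \<Omega>. s \<omega> \<in> bit_positions b K k d} \<in> events" for b
    by measurable

  have J: "J b = P2 b / real M" for b
  proof -
    have "\<P>(\<omega> in \<Omega>. s \<omega> = a) = 1 / real M" if "a \<in> bit_positions b K k d" for a
      using that assms(11) unfolding bit_positions_def M by blast
    then show ?thesis
      unfolding J_def P2_def prob_discrete_plus_noise[OF indep finite_bit_positions sets_in_regions[OF finite_regions]]
      by (simp add: sum_divide_distrib)
  qed
  have P23: "P2 b = P3 b" for b
    unfolding P2_def P3_def sum_bit_positions[OF k less_imp_neq[OF d, symmetric]]
    by (intro sum.cong refl prob_in_regions[OF k d]) measurable
  have P34: "P3 b = P4 b / 2" for b
    unfolding P3_def P4_def sum_divide_distrib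
    by (intro sum.cong refl prob_normal_interval[OF \<open>0 < N0\<close> d delta_l_le_delta_u[OF k] normal])

  have P: "P_PAM \<Omega> s n K k d = (J False + J True) / real K"
  proof -
    have wrong: "{\<omega> \<in> space \<Omega>. wrong_bit s n K k d \<omega>} =
        {\<omega> \<in> space \<Omega>. s \<omega> \<in> bit_positions False K k d \<and> s \<omega> + n \<omega> \<odot> regions (\<not> False) K k d} \<union>
        {\<omega> \<in> space \<Omega>. s \<omega> \<in> bit_positions True K k d \<and> s \<omega> + n \<omega> \<odot> regions (\<not> True) K k d}"
      unfolding wrong_bit_def ex_bool_eq by blast
    then have "{\<omega> \<in> space \<Omega>. wrong_bit s n K k d \<omega>} \<in> events"
      using meas by simp
    then have "P_PAM \<Omega> s n K k d = \<P>(\<omega> in \<Omega>. wrong_bit s n K k d \<omega>) / real K"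
      unfolding P_PAM_def using k by (intro prob_bit_experiment) auto
    also have "\<P>(\<omega> in \<Omega>. wrong_bit s n K k d \<omega>) = J False + J True"
      unfolding wrong J_def
      by (intro finite_measure_Union meas) (use d in \<open>auto dest: disjoint_bit_positions[rotated]\<close>)
    finally show ?thesis .
  qed
  have weight: "bit_weight \<Omega> s b K k d * (J b / S b) = J b / real K" for b
  proof -
    have "J b \<le> S b"
      unfolding J_def S_def by (intro finite_measure_mono meas_S) auto
    moreover have "0 \<le> J b" unfolding J_def by simp
    moreover have "bit_weight \<Omega> s b K k d = S b / real K"
      unfolding bit_weight_def S_def using k by (intro prob_bit_experiment meas_S) auto
    \<comment> \<open>If \<open>S b = 0\<close>, then \<open>J b = 0\<close> as well, so the
      convention for division by zero does no harm.\<close>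
    ultimately show ?thesis by (cases "S b = 0") auto
  qed
  have cond: "\<P>(\<omega> in \<Omega>. s \<omega> + n \<omega> \<odot> regions (\<not> b) K k d \<bar> s \<omega> \<in> bit_positions b K k d) = J b / S b" for b
    unfolding J_def S_def cond_prob_def by (simp add: conj_commute)

  have "P_PAM \<Omega> s n K k d = bit_weight \<Omega> s False K k d * (J False / S False)
      + bit_weight \<Omega> s True K k d * (J True / S True)"
    unfolding weight P by (simp add: add_divide_distrib)
  moreover have P2: "P_PAM \<Omega> s n K k d = 1 / (real M * real K) * (P2 False + P2 True)"
    unfolding P J by (simp add: add_divide_distrib)
  moreover have P3: "P_PAM \<Omega> s n K k d = 1 / (real M * real K) * (P3 False + P3 True)"
    using P2 unfolding P23 .
  moreover have "P_PAM \<Omega> s n K k d = 1 / (2 * real M * real K) * (P4 False + P4 True)"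
    using P3 unfolding P34 by (simp add: add_divide_distrib)
  ultimately show ?thesis
    unfolding cond[symmetric] P2_def P3_def P4_def by simp
qed

end
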